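(* Let $0\to(V,[~,~]_V=0,S)\xrightarrow{i}(\mathfrak{e},[~,~]_\mathfrak{e},U)\xrightarrow{p}(\mathfrak{g},[~,~]_\mathfrak{g},N)\to0$ be an abelian extension of the Nijenhuis Lie algebra $(\mathfrak{g},[~,~]_\mathfrak{g},N)$ by the Nijenhuis representation $(V,\rho,S)$. Then a pair $(D_V,D_\mathfrak{g})\in\mathrm{Der}(V,S)\times\mathrm{Der}(\mathfrak{g},N)$ of Nijenhuis Lie algebra derivations is inducible if and only if $(D_V,D_\mathfrak{g})\in\mathcal{D}_\rho$ and $\mathcal{W}(D_V,D_\mathfrak{g})=0$.
   Context: All vector spaces are over a fixed field. A Nijenhuis operator on a Lie algebra $(\mathfrak{g},[~,~]_\mathfrak{g})$ is a linear map $N:\mathfrak{g}\to\mathfrak{g}$ with $[N(x),N(y)]_\mathfrak{g}=N([N(x),y]_\mathfrak{g}+[x,N(y)]_\mathfrak{g}-N[x,y]_\mathfrak{g})$ for all $x,y\in\mathfrak{g}$. A Nijenhuis Lie algebra is a Lie algebra with a Nijenhuis operator; homomorphisms are Lie algebra homomorphisms commuting with the Nijenhuis operators. A Nijenhuis representation of $(\mathfrak{g},[~,~]_\mathfrak{g},N)$ is a triple $(V,\rho,S)$ with $(V,\rho)$ a representation of the Lie algebra $\mathfrak{g}$ and $S:V\to V$ linear with $\rho_{N(x)}S(v)=S(\rho_{N(x)}v+\rho_xS(v)-S(\rho_xv))$ for all $x\in\mathfrak{g}$, $v\in V$. $\mathrm{Der}(\mathfrak{g},N)$ is the space of Nijenhuis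 Lie algebra derivations: Lie algebra derivations $D$ of $\mathfrak{g}$ with $N\circ D=D\circ N$. $(V,S)$ is regarded as a Nijenhuis Lie algebra with zero bracket, so $\mathrm{Der}(V,S)$ is the space of linear endomorphisms of $V$ commuting with $S$. An abelian extension of $(\mathfrak{g},N)$ by the Nijenhuis representation $(V,\rho,S)$ is a short exact sequence of Nijenhuis Lie algebras $0\to(V,0,S)\xrightarrow{i}(\mathfrak{e},[~,~]_\mathfrak{e},U)\xrightarrow{p}(\mathfrak{g},[~,~]_\mathfrak{g},N)\to0$, with $V$ identified with $i(V)\subset\mathfrak{e}$, such that $\rho_xv=[s(x),v]_\mathfrak{e}$ for any section $s$ of $p$ (a linear map $s:\mathfrak{g}\to\mathfrak{e}$ with $ps=\mathrm{Id}_\mathfrak{g}$; this is independent of $s$). $\mathrm{Der}_V(\mathfrak{e},U)=\{D\in\mathrm{Der}(\mathfrak{e},U)\mid D(V)\subset V\}$, and $\eta:\mathrm{Der}_V(\mathfrak{e},U)\to\mathrm{Der}(V,S)\times\mathrm{Der}(\mathfrak{g},N)$, $\eta(D)=(D|_V,\overline{D})$ with $\overline{D}=pDs$ (independent of the section $s$). A pair $(D_V,D_\mathfrak{g})$ is inducible if it lies in the image of $\eta$. $\mathcal{D}_\rho=\{(D_V,D_\mathfrak{g})\in\mathrm{Der}(V,S)\times\mathrm{Der}(\mathfrak{g},N)\mid D_V(\rho_xv)=\rho_{D_\mathfrak{g}(x)}v+\rho_xD_V(v)\ \forall x\in\mathfrak{g},v\in V\}$. A 2-cocycle of $(\mathfrak{g},N)$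 with coefficients in $(V,\rho,S)$ is a pair $(\chi,F)$ of linear maps $\chi:\wedge^2\mathfrak{g}\to V$, $F:\mathfrak{g}\to V$ such that for all $x,y,z\in\mathfrak{g}$: (1) $\rho_x\chi(y,z)+\rho_y\chi(z,x)+\rho_z\chi(x,y)-\chi([x,y]_\mathfrak{g},z)-\chi([y,z]_\mathfrak{g},x)-\chi([z,x]_\mathfrak{g},y)=0$; (2) $\chi(N(x),N(y))-S(\chi(N(x),y)+\chi(x,N(y))-S(\chi(x,y)))-F([N(x),y]_\mathfrak{g}+[x,N(y)]_\mathfrak{g}-N[x,y]_\mathfrak{g})+\rho_{N(x)}F(y)-\rho_{N(y)}F(x)-S(\rho_xF(y)-\rho_yF(x)-F[x,y]_\mathfrak{g})=0$. $(\chi,F)$, $(\chi',F')$ are cohomologous if there is a linear map $\varphi:\mathfrak{g}\to V$ with $\chi(x,y)-\chi'(x,y)=\rho_x\varphi(y)-\rho_y\varphi(x)-\varphi([x,y]_\mathfrak{g})$ and $F(x)-F'(x)=S(\varphi(x))-\varphi(N(x))$. $H^2((\mathfrak{g},N);(V,S))$ is the space of 2-cocycles modulo this relation. A section $s$ of the extension produces the 2-cocycle $\chi(x,y)=[s(x),s(y)]_\mathfrak{e}-s[x,y]_\mathfrak{g}$, $F(x)=(Us-sN)(x)$. Wells map: $\mathcal{W}:\mathcal{D}_\rho\to H^2((\mathfrak{g},N);(V,S))$, $\mathcal{W}(D_V,D_\mathfrak{g})=[(\chi_{(D_V,D_\mathfrak{g})},F_{(D_V,D_\mathfrak{g})})]$,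 where $(\chi,F)$ is the 2-cocycle produced by a section $s$ and $\chi_{(D_V,D_\mathfrak{g})}(x,y)=D_V(\chi(x,y))-\chi(D_\mathfrak{g}(x),y)-\chi(x,D_\mathfrak{g}(y))$, $F_{(D_V,D_\mathfrak{g})}(x)=D_V(F(x))-F(D_\mathfrak{g}(x))$; this pair is a 2-cocycle and its class is independent of $s$. *)

theory Defs
  imports Complex_Main
begin

section \<open>Nijenhuis Lie algebras and their representations\<close>

text \<open>
  The underlying vector space of a structure is the whole type \<open>'a\<close> with its additive group and
  the scalar multiplication \<open>scl\<close>. A Lie algebra together with a linear operator is bundled as
  one record.
\<close>

record ('k, 'a) nla =
  scl :: "'k \<Rightarrow> 'a \<Rightarrow> 'a"
  brk :: "'a \<Rightarrow> 'a \<Rightarrow> 'a"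
  nij :: "'a \<Rightarrow> 'a"

definition bilin :: "('k::field \<Rightarrow> 'a::ab_group_add \<Rightarrow> 'a) \<Rightarrow> ('k \<Rightarrow> 'b::ab_group_add \<Rightarrow> 'b)
    \<Rightarrow> ('k \<Rightarrow> 'c::ab_group_add \<Rightarrow> 'c) \<Rightarrow> ('a \<Rightarrow> 'b \<Rightarrow> 'c) \<Rightarrow> bool" where
  "bilin s1 s2 s3 f \<longleftrightarrow>
     (\<forall>x. Vector_Spaces.linear s2 s3 (f x)) \<and> (\<forall>y. Vector_Spaces.linear s1 s3 (\<lambda>x. f x y))"

definition lie_bracket :: "('k::field \<Rightarrow> 'a::ab_group_add \<Rightarrow> 'a) \<Rightarrow> ('a \<Rightarrow> 'a \<Rightarrow> 'a) \<Rightarrow> bool" where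
  "lie_bracket s b \<longleftrightarrow> bilin s s s b \<and> (\<forall>x. b x x = 0) \<and>
     (\<forall>x y z. b x (b y z) + b y (b z x) + b z (b x y) = 0)"

definition nijenhuis_operator ::
  "('k::field \<Rightarrow> 'a::ab_group_add \<Rightarrow> 'a) \<Rightarrow> ('a \<Rightarrow> 'a \<Rightarrow> 'a) \<Rightarrow> ('a \<Rightarrow> 'a) \<Rightarrow> bool" where
  "nijenhuis_operator s b N \<longleftrightarrow> Vector_Spaces.linear s s N \<and>
     (\<forall>x y. b (N x) (N y) = N (b (N x) y + b x (N y) - N (b x y)))"

definition nijenhuis_lie :: "('k::field, 'a::ab_group_add) nla \<Rightarrow> bool" where
  "nijenhuis_lie L \<longleftrightarrow> vector_space (scl L) \<and> lie_bracket (scl L) (brk L) \<and>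
     nijenhuis_operator (scl L) (brk L) (nij L)"

definition nijenhuis_hom :: "('k::field, 'a::ab_group_add) nla \<Rightarrow> ('k, 'b::ab_group_add) nla
    \<Rightarrow> ('a \<Rightarrow> 'b) \<Rightarrow> bool" where
  "nijenhuis_hom L M f \<longleftrightarrow> Vector_Spaces.linear (scl L) (scl M) f \<and>
     (\<forall>x y. f (brk L x y) = brk M (f x) (f y)) \<and> (\<forall>x. f (nij L x) = nij M (f x))"

definition lie_representation :: "('k::field, 'g::ab_group_add) nla
    \<Rightarrow> ('k \<Rightarrow> 'v::ab_group_add \<Rightarrow> 'v) \<Rightarrow> ('g \<Rightarrow> 'v \<Rightarrow> 'v) \<Rightarrow> bool" where
  "lie_representation G s \<rho> \<longleftrightarrow> bilin (scl G) s s \<rho> \<and>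
     (\<forall>x y v. \<rho> (brk G x y) v = \<rho> x (\<rho> y v) - \<rho> y (\<rho> x v))"

definition nijenhuis_representation :: "('k::field, 'g::ab_group_add) nla
    \<Rightarrow> ('k \<Rightarrow> 'v::ab_group_add \<Rightarrow> 'v) \<Rightarrow> ('g \<Rightarrow> 'v \<Rightarrow> 'v) \<Rightarrow> ('v \<Rightarrow> 'v) \<Rightarrow> bool" where
  "nijenhuis_representation G s \<rho> S \<longleftrightarrow> vector_space s \<and> lie_representation G s \<rho> \<and>
     Vector_Spaces.linear s s S \<and>
     (\<forall>x v. \<rho> (nij G x) (S v) = S (\<rho> (nij G x) v + \<rho> x (S v) - S (\<rho> x v)))"

definition Der :: "('k::field, 'a::ab_group_add) nla \<Rightarrow> ('a \<Rightarrow> 'a) set" where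
  "Der L = {D. Vector_Spaces.linear (scl L) (scl L) D \<and>
     (\<forall>x y. D (brk L x y) = brk L (D x) y + brk L x (D y)) \<and> nij L \<circ> D = D \<circ> nij L}"

section \<open>Abelian extensions and inducible pairs\<close>

definition is_section :: "('k::field, 'g::ab_group_add) nla \<Rightarrow> ('k, 'e::ab_group_add) nla
    \<Rightarrow> ('e \<Rightarrow> 'g) \<Rightarrow> ('g \<Rightarrow> 'e) \<Rightarrow> bool" where
  "is_section G E p s \<longleftrightarrow> Vector_Spaces.linear (scl G) (scl E) s \<and> p \<circ> s = id"

text \<open>
  The kernel is the Nijenhuis Lie algebra \<open>V\<close> with zero bracket; its operator \<open>nij V\<close> is the
  operator of the representation. The embedding \<open>i\<close> is kept explicit.
\<close>

definition abelian_extension :: "('k::field, 'v::ab_group_add) nla \<Rightarrow> ('v \<Rightarrow> 'e)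
    \<Rightarrow> ('k, 'e::ab_group_add) nla \<Rightarrow> ('e \<Rightarrow> 'g) \<Rightarrow> ('k, 'g::ab_group_add) nla
    \<Rightarrow> ('g \<Rightarrow> 'v \<Rightarrow> 'v) \<Rightarrow> bool" where
  "abelian_extension V i E p G \<rho> \<longleftrightarrow>
     nijenhuis_lie V \<and> (\<forall>u v. brk V u v = 0) \<and> nijenhuis_lie E \<and> nijenhuis_lie G \<and>
     nijenhuis_hom V E i \<and> nijenhuis_hom E G p \<and>
     inj i \<and> range i = {e. p e = 0} \<and> surj p \<and>
     (\<forall>s. is_section G E p s \<longrightarrow> (\<forall>x v. i (\<rho> x v) = brk E (s x) (i v)))"

text \<open>
  The constructions below that need a section use a fixed chosen one; sections exist, and the
  results do not depend on the choice (see the lemmas at the end of this theory).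
\<close>

definition some_section :: "('k::field, 'g::ab_group_add) nla \<Rightarrow> ('k, 'e::ab_group_add) nla
    \<Rightarrow> ('e \<Rightarrow> 'g) \<Rightarrow> 'g \<Rightarrow> 'e" where
  "some_section G E p = (SOME s. is_section G E p s)"

definition Der_sub :: "('k::field, 'e::ab_group_add) nla \<Rightarrow> 'e set \<Rightarrow> ('e \<Rightarrow> 'e) set" where
  "Der_sub E W = {D \<in> Der E. D ` W \<subseteq> W}"

text \<open>\<open>inv i \<circ> D \<circ> i\<close> is the restriction of \<open>D\<close> to \<open>i(V)\<close>, transported to \<open>V\<close>.\<close>

definition eta :: "('v::ab_group_add \<Rightarrow> 'e::ab_group_add) \<Rightarrow> ('k::field, 'e) nla \<Rightarrow> ('e \<Rightarrow> 'g)
    \<Rightarrow> ('k, 'g::ab_group_add) nla \<Rightarrow> ('e \<Rightarrow> 'e) \<Rightarrow> ('v \<Rightarrow> 'v) \<times> ('g \<Rightarrow> 'g)" where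
  "eta i E p G D = (inv i \<circ> D \<circ> i, p \<circ> D \<circ> some_section G E p)"

definition inducible :: "('v::ab_group_add \<Rightarrow> 'e::ab_group_add) \<Rightarrow> ('k::field, 'e) nla
    \<Rightarrow> ('e \<Rightarrow> 'g) \<Rightarrow> ('k, 'g::ab_group_add) nla \<Rightarrow> ('v \<Rightarrow> 'v) \<times> ('g \<Rightarrow> 'g) \<Rightarrow> bool" where
  "inducible i E p G P \<longleftrightarrow> P \<in> eta i E p G ` Der_sub E (range i)"

definition D_rho :: "('k::field, 'v::ab_group_add) nla \<Rightarrow> ('k, 'g::ab_group_add) nla
    \<Rightarrow> ('g \<Rightarrow> 'v \<Rightarrow> 'v) \<Rightarrow> (('v \<Rightarrow> 'v) \<times> ('g \<Rightarrow> 'g)) set" where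
  "D_rho V G \<rho> = {(DV, Dg) \<in> Der V \<times> Der G.
     \<forall>x v. DV (\<rho> x v) = \<rho> (Dg x) v + \<rho> x (DV v)}"

section \<open>Second cohomology\<close>

text \<open>A linear map on the exterior square is rendered as an alternating bilinear map.\<close>

definition two_cocycles :: "('k::field, 'g::ab_group_add) nla \<Rightarrow> ('k, 'v::ab_group_add) nla
    \<Rightarrow> ('g \<Rightarrow> 'v \<Rightarrow> 'v) \<Rightarrow> (('g \<Rightarrow> 'g \<Rightarrow> 'v) \<times> ('g \<Rightarrow> 'v)) set" where
  "two_cocycles G V \<rho> = {(\<chi>, F).
     bilin (scl G) (scl G) (scl V) \<chi> \<and> (\<forall>x. \<chi> x x = 0) \<and>
     Vector_Spaces.linear (scl G) (scl V) F \<and>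
     (\<forall>x y z. \<rho> x (\<chi> y z) + \<rho> y (\<chi> z x) + \<rho> z (\<chi> x y)
        - \<chi> (brk G x y) z - \<chi> (brk G y z) x - \<chi> (brk G z x) y = 0) \<and>
     (\<forall>x y. \<chi> (nij G x) (nij G y)
        - nij V (\<chi> (nij G x) y + \<chi> x (nij G y) - nij V (\<chi> x y))
        - F (brk G (nij G x) y + brk G x (nij G y) - nij G (brk G x y))
        + \<rho> (nij G x) (F y) - \<rho> (nij G y) (F x)
        - nij V (\<rho> x (F y) - \<rho> y (F x) - F (brk G x y)) = 0)}"

definition cohomologous :: "('k::field, 'g::ab_group_add) nla \<Rightarrow> ('k, 'v::ab_group_add) nla
    \<Rightarrow> ('g \<Rightarrow> 'v \<Rightarrow> 'v)
    \<Rightarrow> ((('g \<Rightarrow> 'g \<Rightarrow> 'v) \<times> ('g \<Rightarrow> 'v)) \<times> (('g \<Rightarrow> 'g \<Rightarrow> 'v) \<times> ('g \<Rightarrow> 'v))) set" where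
  "cohomologous G V \<rho> = {((\<chi>, F), (\<chi>', F')).
     (\<chi>, F) \<in> two_cocycles G V \<rho> \<and> (\<chi>', F') \<in> two_cocycles G V \<rho> \<and>
     (\<exists>\<phi>. Vector_Spaces.linear (scl G) (scl V) \<phi> \<and>
        (\<forall>x y. \<chi> x y - \<chi>' x y = \<rho> x (\<phi> y) - \<rho> y (\<phi> x) - \<phi> (brk G x y)) \<and>
        (\<forall>x. F x - F' x = nij V (\<phi> x) - \<phi> (nij G x)))}"

definition H2 :: "('k::field, 'g::ab_group_add) nla \<Rightarrow> ('k, 'v::ab_group_add) nla
    \<Rightarrow> ('g \<Rightarrow> 'v \<Rightarrow> 'v) \<Rightarrow> (('g \<Rightarrow> 'g \<Rightarrow> 'v) \<times> ('g \<Rightarrow> 'v)) set set" where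
  "H2 G V \<rho> = two_cocycles G V \<rho> // cohomologous G V \<rho>"

definition cohom_class :: "('k::field, 'g::ab_group_add) nla \<Rightarrow> ('k, 'v::ab_group_add) nla
    \<Rightarrow> ('g \<Rightarrow> 'v \<Rightarrow> 'v) \<Rightarrow> ('g \<Rightarrow> 'g \<Rightarrow> 'v) \<times> ('g \<Rightarrow> 'v)
    \<Rightarrow> (('g \<Rightarrow> 'g \<Rightarrow> 'v) \<times> ('g \<Rightarrow> 'v)) set" where
  "cohom_class G V \<rho> c = cohomologous G V \<rho> `` {c}"

definition H2_zero :: "('k::field, 'g::ab_group_add) nla \<Rightarrow> ('k, 'v::ab_group_add) nla
    \<Rightarrow> ('g \<Rightarrow> 'v \<Rightarrow> 'v) \<Rightarrow> (('g \<Rightarrow> 'g \<Rightarrow> 'v) \<times> ('g \<Rightarrow> 'v)) set" where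
  "H2_zero G V \<rho> = cohom_class G V \<rho> (\<lambda>x y. 0, \<lambda>x. 0)"

section \<open>The Wells map\<close>

definition section_cocycle :: "('v::ab_group_add \<Rightarrow> 'e::ab_group_add) \<Rightarrow> ('k::field, 'e) nla
    \<Rightarrow> ('k, 'g::ab_group_add) nla \<Rightarrow> ('g \<Rightarrow> 'e) \<Rightarrow> ('g \<Rightarrow> 'g \<Rightarrow> 'v) \<times> ('g \<Rightarrow> 'v)" where
  "section_cocycle i E G s =
     (\<lambda>x y. inv i (brk E (s x) (s y) - s (brk G x y)),
      \<lambda>x. inv i (nij E (s x) - s (nij G x)))"

definition pair_cocycle :: "('v::ab_group_add \<Rightarrow> 'v) \<times> ('g \<Rightarrow> 'g)
    \<Rightarrow> ('g \<Rightarrow> 'g \<Rightarrow> 'v) \<times> ('g \<Rightarrow> 'v) \<Rightarrow> ('g \<Rightarrow> 'g \<Rightarrow> 'v) \<times> ('g \<Rightarrow> 'v)" where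
  "pair_cocycle = (\<lambda>(DV, Dg) (\<chi>, F).
     (\<lambda>x y. DV (\<chi> x y) - \<chi> (Dg x) y - \<chi> x (Dg y),
      \<lambda>x. DV (F x) - F (Dg x)))"

definition Wells :: "('k::field, 'v::ab_group_add) nla \<Rightarrow> ('v \<Rightarrow> 'e)
    \<Rightarrow> ('k, 'e::ab_group_add) nla \<Rightarrow> ('e \<Rightarrow> 'g) \<Rightarrow> ('k, 'g::ab_group_add) nla
    \<Rightarrow> ('g \<Rightarrow> 'v \<Rightarrow> 'v) \<Rightarrow> ('v \<Rightarrow> 'v) \<times> ('g \<Rightarrow> 'g)
    \<Rightarrow> (('g \<Rightarrow> 'g \<Rightarrow> 'v) \<times> ('g \<Rightarrow> 'v)) set" where
  "Wells V i E p G \<rho> P =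
     cohom_class G V \<rho> (pair_cocycle P (section_cocycle i E G (some_section G E p)))"

section \<open>Independence of the section\<close>

lemma linear_facts:
  assumes "Vector_Spaces.linear s1 s2 f"
  shows "f (x + y) = f x + f y" "f (x - y) = f x - f y" "f (- x) = - f x" "f 0 = 0"
    "f (s1 c x) = s2 c (f x)"
proof -
  interpret Vector_Spaces.linear s1 s2 f by fact
  show "f (x + y) = f x + f y" "f (x - y) = f x - f y" "f (- x) = - f x" "f 0 = 0"
    "f (s1 c x) = s2 c (f x)"
    by (simp_all add: add diff neg zero scale)
qed

lemma bilin_facts:
  assumes "bilin s1 s2 s3 f"
  shows "f (x + y) z = f x z + f y z" "f (x - y) z = f x z - f y z" "f (- x) z = - f x z"
    "f 0 z = 0" "f (s1 c x) z = s3 c (f x z)"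
    "f u (v + w) = f u v + f u w" "f u (v - w) = f u v - f u w" "f u (- v) = - f u v"
    "f u 0 = 0" "f u (s2 c v) = s3 c (f u v)"
proof -
  have "Vector_Spaces.linear s1 s3 (\<lambda>x. f x z)" "Vector_Spaces.linear s2 s3 (f u)"
    using assms by (auto simp: bilin_def)
  from linear_facts[OF this(1)] linear_facts[OF this(2)]
  show "f (x + y) z = f x z + f y z" "f (x - y) z = f x z - f y z" "f (- x) z = - f x z"
    "f 0 z = 0" "f (s1 c x) z = s3 c (f x z)"
    "f u (v + w) = f u v + f u w" "f u (v - w) = f u v - f u w" "f u (- v) = - f u v"
    "f u 0 = 0" "f u (s2 c v) = s3 c (f u v)"
    by auto
qed

lemma linearI:
  assumes "vector_space s1" "vector_space s2"
    and "\<And>x y. f (x + y) = f x + f y" "\<And>c x. f (s1 c x) = s2 c (f x)"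
  shows "Vector_Spaces.linear s1 s2 f"
  using assms by (simp add: Vector_Spaces.linear_iff)

lemma alternating_antisym:
  assumes "bilin s s s3 f" "\<And>x. f x x = 0"
  shows "f y x = - f x y"
proof -
  have "f (x + y) (x + y) = 0" by (rule assms)
  then have "f x y + f y x = 0"
    by (simp only: bilin_facts[OF assms(1)]) (simp add: assms(2) add.commute)
  then show ?thesis by (metis add.commute eq_neg_iff_add_eq_0)
qed

lemma section_exists:
  assumes "abelian_extension V i E p G \<rho>"
  shows "is_section G E p (some_section G E p)"
proof -
  have p: "Vector_Spaces.linear (scl E) (scl G) p" "surj p"
    using assms by (auto simp: abelian_extension_def nijenhuis_hom_def)
  interpret vector_space_pair "scl E" "scl G"
    using p(1) by (simp add: vector_space_pair_def Vector_Spaces.linear_def)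
  obtain s where "is_section G E p s"
    unfolding is_section_def using linear_surjective_right_inverse[OF p] by blast
  then show ?thesis unfolding some_section_def by (rule someI[where P = "is_section G E p"])
qed

lemma eta_independent_of_section:
  assumes "abelian_extension V i E p G \<rho>" "D \<in> Der_sub E (range i)" "is_section G E p s"
  shows "eta i E p G D = (inv i \<circ> D \<circ> i, p \<circ> D \<circ> s)"
proof -
  let ?t = "some_section G E p"
  have t: "is_section G E p ?t" by (rule section_exists[OF assms(1)])
  have ker: "range i = {e. p e = 0}" and p: "Vector_Spaces.linear (scl E) (scl G) p"
    using assms(1) by (auto simp: abelian_extension_def nijenhuis_hom_def)
  have D: "Vector_Spaces.linear (scl E) (scl E) D" "\<And>e. p e = 0 \<Longrightarrow> p (D e) = 0"
    using assms(2) ker by (auto simp: Der_sub_def Der_def)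
  have "p (D (?t x)) = p (D (s x))" for x
  proof -
    have "p (?t x - s x) = 0"
      using t assms(3) by (simp add: is_section_def linear_facts[OF p] fun_eq_iff)
    from D(2)[OF this] show ?thesis
      by (simp add: linear_facts[OF p] linear_facts[OF D(1)])
  qed
  then show ?thesis by (simp add: eta_def fun_eq_iff)
qed

locale abelian_extension_loc =
  fixes V :: "('k::field, 'v::ab_group_add) nla" and i :: "'v \<Rightarrow> 'e::ab_group_add"
    and E :: "('k, 'e) nla" and p :: "'e \<Rightarrow> 'g::ab_group_add"
    and G :: "('k, 'g) nla" and \<rho> :: "'g \<Rightarrow> 'v \<Rightarrow> 'v"
  assumes rep: "nijenhuis_representation G (scl V) \<rho> (nij V)"
    and ext: "abelian_extension V i E p G \<rho>"
begin

lemma vs: "vector_space (scl V)" "vector_space (scl G)" "vector_space (scl E)"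
  using ext by (auto simp: abelian_extension_def nijenhuis_lie_def)

lemma lin:
  "Vector_Spaces.linear (scl V) (scl E) i" "Vector_Spaces.linear (scl E) (scl G) p"
  "Vector_Spaces.linear (scl V) (scl V) (nij V)" "Vector_Spaces.linear (scl G) (scl G) (nij G)"
  "Vector_Spaces.linear (scl E) (scl E) (nij E)"
  using ext by (auto simp: abelian_extension_def nijenhuis_lie_def nijenhuis_operator_def
      nijenhuis_hom_def)

lemma bil: "bilin (scl G) (scl V) (scl V) \<rho>" "bilin (scl G) (scl G) (scl G) (brk G)"
  "bilin (scl E) (scl E) (scl E) (brk E)"
  using ext rep by (auto simp: abelian_extension_def nijenhuis_lie_def lie_bracket_def
      nijenhuis_representation_def lie_representation_def)

lemmas lf = linear_facts[OF lin(1)] linear_facts[OF lin(2)] linear_facts[OF lin(3)]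
  linear_facts[OF lin(4)] linear_facts[OF lin(5)]
  bilin_facts[OF bil(1)] bilin_facts[OF bil(2)] bilin_facts[OF bil(3)]

lemma alt: "brk G x x = 0" "brk E e e = 0"
  using ext by (auto simp: abelian_extension_def nijenhuis_lie_def lie_bracket_def)

lemma anti: "brk G y x = - brk G x y" "brk E e f = - brk E f e"
  by (rule alternating_antisym bil alt)+

lemma jac: "brk G x (brk G y z) + brk G y (brk G z x) + brk G z (brk G x y) = 0"
   "brk E e (brk E f h) + brk E f (brk E h e) + brk E h (brk E e f) = 0"
  using ext by (auto simp: abelian_extension_def nijenhuis_lie_def lie_bracket_def)

lemma nijop: "brk G (nij G x) (nij G y)
    = nij G (brk G (nij G x) y + brk G x (nij G y) - nij G (brk G x y))"
  "brk E (nij E e) (nij E f)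
    = nij E (brk E (nij E e) f + brk E e (nij E f) - nij E (brk E e f))"
  using ext by (auto simp: abelian_extension_def nijenhuis_lie_def nijenhuis_operator_def)

lemma ip: "i (nij V v) = nij E (i v)" "brk E (i v) (i w) = 0" "p (brk E e f) = brk G (p e) (p f)"
  "p (nij E e) = nij G (p e)" "p (i v) = 0" "p e = 0 \<Longrightarrow> i (inv i e) = e" "inj i"
proof -
  show "i (nij V v) = nij E (i v)" "p (brk E e f) = brk G (p e) (p f)"
    "p (nij E e) = nij G (p e)" "p (i v) = 0" "p e = 0 \<Longrightarrow> i (inv i e) = e" "inj i"
    using ext by (auto simp: abelian_extension_def nijenhuis_hom_def f_inv_into_f)
  have "i (brk V v w) = brk E (i v) (i w)" "brk V v w = 0"
    using ext by (auto simp: abelian_extension_def nijenhuis_hom_def)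
  then show "brk E (i v) (i w) = 0" by (simp add: lf)
qed

lemma act: "is_section G E p s \<Longrightarrow> i (\<rho> x v) = brk E (s x) (i v)"
  using ext by (auto simp: abelian_extension_def)

lemma sect:
  assumes "is_section G E p s"
  shows "Vector_Spaces.linear (scl G) (scl E) s" "p (s x) = x"
  using assms by (auto simp: is_section_def fun_eq_iff)

lemma i_section_cocycle:
  assumes "is_section G E p s"
  shows "i (fst (section_cocycle i E G s) x y) = brk E (s x) (s y) - s (brk G x y)"
    "i (snd (section_cocycle i E G s) x) = nij E (s x) - s (nij G x)"
  using sect(2)[OF assms] by (simp_all add: section_cocycle_def ip(3,4) ip(6) lf)

lemma i_eq: "i u = i v \<Longrightarrow> u = v"
  using ip(7) by (auto dest: injD)

lemma section_cocycle_in: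
  assumes s: "is_section G E p s"
  shows "section_cocycle i E G s \<in> two_cocycles G V \<rho>"
proof -
  obtain \<chi> F where c: "section_cocycle i E G s = (\<chi>, F)" by fastforce
  note ls = linear_facts[OF sect(1)[OF s]]
  have ix: "i (\<chi> x y) = brk E (s x) (s y) - s (brk G x y)" for x y
    using i_section_cocycle(1)[OF s] c by simp
  have iF: "i (F x) = nij E (s x) - s (nij G x)" for x
    using i_section_cocycle(2)[OF s] c by simp
  have S: "scl E a (x - y) = scl E a x - scl E a y" for a x y
    using vs(3) by (simp add: vector_space.vector_space_assms module.scale_right_diff_distrib
        module_iff_vector_space)
  have lx: "Vector_Spaces.linear (scl G) (scl V) (\<chi> x)" for x
    by (intro linearI vs i_eq) (simp_all add: lf ls ix S)
  have ly: "Vector_Spaces.linear (scl G) (scl V) (\<lambda>x. \<chi> x y)" for y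
    by (intro linearI vs i_eq) (simp_all add: lf ls ix S)
  have bx: "bilin (scl G) (scl G) (scl V) \<chi>"
    using lx ly by (simp add: bilin_def)
  have ax: "\<chi> x x = 0" for x
    by (rule i_eq) (simp add: ix alt lf ls)
  have lF: "Vector_Spaces.linear (scl G) (scl V) F"
    by (intro linearI vs i_eq) (simp_all add: lf ls iF S)
  have c1: "\<rho> x (\<chi> y z) + \<rho> y (\<chi> z x) + \<rho> z (\<chi> x y)
        - \<chi> (brk G x y) z - \<chi> (brk G y z) x - \<chi> (brk G z x) y = 0" for x y z
  proof (rule i_eq)
    have j: "s (brk G x (brk G y z) + brk G y (brk G z x) + brk G z (brk G x y)) = 0"
      by (simp add: jac ls)
    have e: "brk E (s (brk G x y)) (s z) = - brk E (s z) (s (brk G x y))"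
      "brk E (s (brk G y z)) (s x) = - brk E (s x) (s (brk G y z))"
      "brk E (s (brk G z x)) (s y) = - brk E (s y) (s (brk G z x))"
      "brk G (brk G x y) z = - brk G z (brk G x y)"
      "brk G (brk G y z) x = - brk G x (brk G y z)"
      "brk G (brk G z x) y = - brk G y (brk G z x)"
      by (rule anti)+
    show "i (\<rho> x (\<chi> y z) + \<rho> y (\<chi> z x) + \<rho> z (\<chi> x y)
        - \<chi> (brk G x y) z - \<chi> (brk G y z) x - \<chi> (brk G z x) y) = i 0"
      using jac(2)[of "s x" "s y" "s z"] j
      by (simp add: lf ls ix act[OF s] e algebra_simps)
  qed
  have c2: "\<chi> (nij G x) (nij G y)
        - nij V (\<chi> (nij G x) y + \<chi> x (nij G y) - nij V (\<chi> x y))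
        - F (brk G (nij G x) y + brk G x (nij G y) - nij G (brk G x y))
        + \<rho> (nij G x) (F y) - \<rho> (nij G y) (F x)
        - nij V (\<rho> x (F y) - \<rho> y (F x) - F (brk G x y)) = 0" for x y
  proof (rule i_eq)
    have z: "brk E (i (F x)) (i (F y)) = 0" by (rule ip)
    have e: "brk E (s (nij G y)) (nij E (s x)) = - brk E (nij E (s x)) (s (nij G y))"
      "brk E (s (nij G y)) (s (nij G x)) = - brk E (s (nij G x)) (s (nij G y))"
      "brk E (s y) (nij E (s x)) = - brk E (nij E (s x)) (s y)"
      "brk E (s y) (s (nij G x)) = - brk E (s (nij G x)) (s y)"
      by (rule anti)+
    show "i (\<chi> (nij G x) (nij G y)
        - nij V (\<chi> (nij G x) y + \<chi> x (nij G y) - nij V (\<chi> x y))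
        - F (brk G (nij G x) y + brk G x (nij G y) - nij G (brk G x y))
        + \<rho> (nij G x) (F y) - \<rho> (nij G y) (F x)
        - nij V (\<rho> x (F y) - \<rho> y (F x) - F (brk G x y))) = i 0"
      using z nijop(2)[of "s x" "s y"] arg_cong[OF nijop(1)[of x y], of s]
      by (simp add: lf ls ix iF ip(1) act[OF s] e algebra_simps)
  qed
  show ?thesis unfolding c two_cocycles_def using bx ax lF c1 c2 by blast
qed

lemma pair_cocycle_in:
  assumes P: "P \<in> D_rho V G \<rho>" and c: "c \<in> two_cocycles G V \<rho>"
  shows "pair_cocycle P c \<in> two_cocycles G V \<rho>"
proof -
  obtain DV Dg where P': "P = (DV, Dg)" by fastforce
  obtain \<chi> F where c': "c = (\<chi>, F)" by fastforce
  have DV: "Vector_Spaces.linear (scl V) (scl V) DV" "\<And>v. nij V (DV v) = DV (nij V v)"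
    and Dg: "Vector_Spaces.linear (scl G) (scl G) Dg" "\<And>x. nij G (Dg x) = Dg (nij G x)"
      "\<And>x y. Dg (brk G x y) = brk G (Dg x) y + brk G x (Dg y)"
    and r: "\<And>x v. DV (\<rho> x v) = \<rho> (Dg x) v + \<rho> x (DV v)"
    using P unfolding P' by (auto simp: D_rho_def Der_def fun_eq_iff)
  have bx: "bilin (scl G) (scl G) (scl V) \<chi>" and ax: "\<And>x. \<chi> x x = 0"
    and lF: "Vector_Spaces.linear (scl G) (scl V) F"
    using c unfolding c' two_cocycles_def by auto
  have c1: "\<rho> x (\<chi> y z) + \<rho> y (\<chi> z x) + \<rho> z (\<chi> x y)
        - \<chi> (brk G x y) z - \<chi> (brk G y z) x - \<chi> (brk G z x) y = 0" for x y z
    using c unfolding c' two_cocycles_def by auto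
  have c2: "\<chi> (nij G x) (nij G y)
        - nij V (\<chi> (nij G x) y + \<chi> x (nij G y) - nij V (\<chi> x y))
        - F (brk G (nij G x) y + brk G x (nij G y) - nij G (brk G x y))
        + \<rho> (nij G x) (F y) - \<rho> (nij G y) (F x)
        - nij V (\<rho> x (F y) - \<rho> y (F x) - F (brk G x y)) = 0" for x y
    using c unfolding c' two_cocycles_def by auto
  have anti_x: "\<chi> y x = - \<chi> x y" for x y
    by (rule alternating_antisym[OF bx ax])
  note l = lf linear_facts[OF DV(1)] linear_facts[OF Dg(1)] linear_facts[OF lF] bilin_facts[OF bx]
  have S: "scl V a (x - y) = scl V a x - scl V a y" for a x y
    using vs(1) by (simp add: vector_space.vector_space_assms module.scale_right_diff_distrib
        module_iff_vector_space)
  define X where "X x y = DV (\<chi> x y) - \<chi> (Dg x) y - \<chi> x (Dg y)" for x y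
  define Y where "Y x = DV (F x) - F (Dg x)" for x
  have "bilin (scl G) (scl G) (scl V) X"
    unfolding bilin_def X_def by (intro conjI allI linearI vs) (simp_all add: l S)
  moreover have "X x x = 0" for x
    unfolding X_def using anti_x[of x "Dg x"] by (simp add: ax l)
  moreover have "Vector_Spaces.linear (scl G) (scl V) Y"
    unfolding Y_def by (intro linearI vs) (simp_all add: l S)
  moreover have "\<rho> x (X y z) + \<rho> y (X z x) + \<rho> z (X x y)
        - X (brk G x y) z - X (brk G y z) x - X (brk G z x) y = 0" (is "?L = 0") for x y z
  proof -
    let ?c = "\<lambda>x y z. \<rho> x (\<chi> y z) + \<rho> y (\<chi> z x) + \<rho> z (\<chi> x y)
        - \<chi> (brk G x y) z - \<chi> (brk G y z) x - \<chi> (brk G z x) y"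
    have "?L = DV (?c x y z) - ?c (Dg x) y z - ?c x (Dg y) z - ?c x y (Dg z)"
      unfolding X_def by (simp add: l r Dg(3) algebra_simps)
    then show ?thesis unfolding c1 by (simp add: l)
  qed
  moreover have "X (nij G x) (nij G y)
        - nij V (X (nij G x) y + X x (nij G y) - nij V (X x y))
        - Y (brk G (nij G x) y + brk G x (nij G y) - nij G (brk G x y))
        + \<rho> (nij G x) (Y y) - \<rho> (nij G y) (Y x)
        - nij V (\<rho> x (Y y) - \<rho> y (Y x) - Y (brk G x y)) = 0" (is "?L = 0") for x y
  proof -
    let ?c = "\<lambda>x y. \<chi> (nij G x) (nij G y)
        - nij V (\<chi> (nij G x) y + \<chi> x (nij G y) - nij V (\<chi> x y))
        - F (brk G (nij G x) y + brk G x (nij G y) - nij G (brk G x y))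
        + \<rho> (nij G x) (F y) - \<rho> (nij G y) (F x)
        - nij V (\<rho> x (F y) - \<rho> y (F x) - F (brk G x y))"
    have "?L = DV (?c x y) - ?c (Dg x) y - ?c x (Dg y)"
      unfolding X_def Y_def
      by (simp add: l r Dg(3) Dg(2)[symmetric] DV(2)[symmetric] algebra_simps)
    then show ?thesis unfolding c2 by (simp add: l)
  qed
  ultimately show ?thesis
    unfolding P' c' pair_cocycle_def two_cocycles_def prod.case X_def[symmetric] Y_def[symmetric]
    by blast
qed

lemma equiv_cohomologous: "equiv (two_cocycles G V \<rho>) (cohomologous G V \<rho>)"
proof (rule equivI)
  show "cohomologous G V \<rho> \<subseteq> two_cocycles G V \<rho> \<times> two_cocycles G V \<rho>"
    by (auto simp: cohomologous_def)
  show "refl_on (two_cocycles G V \<rho>) (cohomologous G V \<rho>)"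
  proof (rule refl_onI)
    fix c assume "c \<in> two_cocycles G V \<rho>"
    moreover have "Vector_Spaces.linear (scl G) (scl V) (\<lambda>x. 0)"
      using linear_facts(4)[OF lin(3)] by (intro linearI vs) (simp_all add:
          vs(1) module.scale_zero_right module_iff_vector_space)
    ultimately show "(c, c) \<in> cohomologous G V \<rho>"
      unfolding cohomologous_def by (cases c) (auto intro!: exI[of _ "\<lambda>x. 0"] simp: lf)
  qed
  show "sym (cohomologous G V \<rho>)"
  proof (rule symI)
    fix c d assume "(c, d) \<in> cohomologous G V \<rho>"
    then obtain x f y g \<phi> where e: "c = (x, f)" "d = (y, g)" "c \<in> two_cocycles G V \<rho>"
      "d \<in> two_cocycles G V \<rho>" and l: "Vector_Spaces.linear (scl G) (scl V) \<phi>"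
      and q: "\<And>a b. x a b - y a b = \<rho> a (\<phi> b) - \<rho> b (\<phi> a) - \<phi> (brk G a b)"
        "\<And>a. f a - g a = nij V (\<phi> a) - \<phi> (nij G a)"
      unfolding cohomologous_def by auto
    have "Vector_Spaces.linear (scl G) (scl V) (\<lambda>x. - \<phi> x)"
      by (intro linearI vs) (simp_all add: linear_facts[OF l] vs(1) module.scale_minus_right
          module_iff_vector_space)
    moreover have "y a b - x a b = \<rho> a (- \<phi> b) - \<rho> b (- \<phi> a) - (- \<phi> (brk G a b))" for a b
      using q(1)[of a b] by (simp add: lf algebra_simps)
    moreover have "g a - f a = nij V (- \<phi> a) - (- \<phi> (nij G a))" for a
      using q(2)[of a] by (simp add: lf algebra_simps)
    ultimately show "(d, c) \<in> cohomologous G V \<rho>"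
      using e unfolding cohomologous_def by (auto intro!: exI[of _ "\<lambda>x. - \<phi> x"])
  qed
  show "trans (cohomologous G V \<rho>)"
  proof (rule transI)
    fix c d h assume cd: "(c, d) \<in> cohomologous G V \<rho>" and dh: "(d, h) \<in> cohomologous G V \<rho>"
    obtain x f y g z k where e0: "c = (x, f)" "d = (y, g)" "h = (z, k)"
      by (cases c, cases d, cases h) blast
    have e: "c = (x, f)" "h = (z, k)" "c \<in> two_cocycles G V \<rho>" "h \<in> two_cocycles G V \<rho>"
      using cd dh by (auto simp: cohomologous_def e0)
    obtain \<phi> where l1: "Vector_Spaces.linear (scl G) (scl V) \<phi>"
      and q1: "\<And>a b. x a b - y a b = \<rho> a (\<phi> b) - \<rho> b (\<phi> a) - \<phi> (brk G a b)"
        "\<And>a. f a - g a = nij V (\<phi> a) - \<phi> (nij G a)"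
      using cd unfolding cohomologous_def e0 by blast
    obtain \<psi> where l2: "Vector_Spaces.linear (scl G) (scl V) \<psi>"
      and q2: "\<And>a b. y a b - z a b = \<rho> a (\<psi> b) - \<rho> b (\<psi> a) - \<psi> (brk G a b)"
        "\<And>a. g a - k a = nij V (\<psi> a) - \<psi> (nij G a)"
      using dh unfolding cohomologous_def e0 by blast
    note l = l1 l2 and q = q1 q2
    have "Vector_Spaces.linear (scl G) (scl V) (\<lambda>x. \<phi> x + \<psi> x)"
      by (intro linearI vs) (simp_all add: linear_facts[OF l(1)] linear_facts[OF l(2)]
          vs(1) module.scale_right_distrib module_iff_vector_space)
    moreover have "x a b - z a b = \<rho> a (\<phi> b + \<psi> b) - \<rho> b (\<phi> a + \<psi> a)
        - (\<phi> (brk G a b) + \<psi> (brk G a b))" for a b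
      using arg_cong2[OF q(1)[of a b] q(3)[of a b], of "(+)"] by (simp add: lf algebra_simps)
    moreover have "f a - k a = nij V (\<phi> a + \<psi> a) - (\<phi> (nij G a) + \<psi> (nij G a))" for a
      using arg_cong2[OF q(2)[of a] q(4)[of a], of "(+)"] by (simp add: lf algebra_simps)
    ultimately show "(c, h) \<in> cohomologous G V \<rho>"
      using e unfolding cohomologous_def by (auto intro!: exI[of _ "\<lambda>x. \<phi> x + \<psi> x"])
  qed
qed

theorem Wells_in_H2:
  assumes "P \<in> D_rho V G \<rho>"
  shows "Wells V i E p G \<rho> P \<in> H2 G V \<rho>"
  unfolding Wells_def cohom_class_def H2_def
  by (intro quotientI pair_cocycle_in assms section_cocycle_in section_exists[OF ext])

theorem Wells_independent_of_section:
  assumes P: "P \<in> D_rho V G \<rho>" and s: "is_section G E p s"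
  shows "Wells V i E p G \<rho> P = cohom_class G V \<rho> (pair_cocycle P (section_cocycle i E G s))"
proof -
  define t where "t = some_section G E p"
  have t: "is_section G E p t" unfolding t_def by (rule section_exists[OF ext])
  note ls = linear_facts[OF sect(1)[OF s]] linear_facts[OF sect(1)[OF t]]
  obtain \<chi> F where c: "section_cocycle i E G t = (\<chi>, F)" by fastforce
  obtain \<chi>' F' where c': "section_cocycle i E G s = (\<chi>', F')" by fastforce
  obtain DV Dg where P': "P = (DV, Dg)" by fastforce
  have DV: "Vector_Spaces.linear (scl V) (scl V) DV" "\<And>v. nij V (DV v) = DV (nij V v)"
    and Dg: "Vector_Spaces.linear (scl G) (scl G) Dg" "\<And>x. nij G (Dg x) = Dg (nij G x)"
      "\<And>x y. Dg (brk G x y) = brk G (Dg x) y + brk G x (Dg y)"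
    and r: "\<And>x v. DV (\<rho> x v) = \<rho> (Dg x) v + \<rho> x (DV v)"
    using P unfolding P' by (auto simp: D_rho_def Der_def fun_eq_iff)
  have ix: "i (\<chi> x y) = brk E (t x) (t y) - t (brk G x y)" for x y
    using i_section_cocycle(1)[OF t] c by simp
  have iF: "i (F x) = nij E (t x) - t (nij G x)" for x
    using i_section_cocycle(2)[OF t] c by simp
  have ix': "i (\<chi>' x y) = brk E (s x) (s y) - s (brk G x y)" for x y
    using i_section_cocycle(1)[OF s] c' by simp
  have iF': "i (F' x) = nij E (s x) - s (nij G x)" for x
    using i_section_cocycle(2)[OF s] c' by simp
  define \<psi> where "\<psi> x = inv i (t x - s x)" for x
  have ip': "i (\<psi> x) = t x - s x" for x
    unfolding \<psi>_def by (rule ip(6)) (simp add: lf sect(2)[OF t] sect(2)[OF s])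
  have S: "scl E a (x - y) = scl E a x - scl E a y" "scl V a (u - v) = scl V a u - scl V a v"
    for a x y u v
    using vs by (simp_all add: module.scale_right_diff_distrib module_iff_vector_space)
  have lp: "Vector_Spaces.linear (scl G) (scl V) \<psi>"
    by (intro linearI vs i_eq) (simp_all add: lf ls ip' S)
  note l = linear_facts[OF DV(1)] linear_facts[OF Dg(1)] linear_facts[OF lp]
  have d: "\<chi> x y = \<chi>' x y + (\<rho> x (\<psi> y) - \<rho> y (\<psi> x) - \<psi> (brk G x y))" for x y
  proof (rule i_eq)
    have "brk E (i (\<psi> x)) (i (\<psi> y)) = 0" by (rule ip)
    moreover have "brk E (s y) (t x) = - brk E (t x) (s y)" "brk E (s y) (s x) = - brk E (s x) (s y)"
      by (rule anti)+
    ultimately show "i (\<chi> x y) = i (\<chi>' x y + (\<rho> x (\<psi> y) - \<rho> y (\<psi> x) - \<psi> (brk G x y)))"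
      by (simp add: lf ls ix ix' ip' act[OF s] algebra_simps)
  qed
  have f: "F x = F' x + (nij V (\<psi> x) - \<psi> (nij G x))" for x
    by (rule i_eq) (simp add: lf ls iF iF' ip' ip(1))
  define \<phi> where "\<phi> x = DV (\<psi> x) - \<psi> (Dg x)" for x
  have "Vector_Spaces.linear (scl G) (scl V) \<phi>"
    unfolding \<phi>_def by (intro linearI vs) (simp_all add: lf l S)
  moreover have "(DV (\<chi> x y) - \<chi> (Dg x) y - \<chi> x (Dg y)) - (DV (\<chi>' x y) - \<chi>' (Dg x) y - \<chi>' x (Dg y))
      = \<rho> x (\<phi> y) - \<rho> y (\<phi> x) - \<phi> (brk G x y)" for x y
    unfolding d \<phi>_def by (simp add: lf l r Dg(3) algebra_simps)
  moreover have "(DV (F x) - F (Dg x)) - (DV (F' x) - F' (Dg x)) = nij V (\<phi> x) - \<phi> (nij G x)" for x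
    unfolding f \<phi>_def by (simp add: lf l Dg(2) DV(2) algebra_simps)
  moreover have "pair_cocycle P (\<chi>, F) \<in> two_cocycles G V \<rho>"
    "pair_cocycle P (\<chi>', F') \<in> two_cocycles G V \<rho>"
    using pair_cocycle_in[OF P section_cocycle_in[OF t]] pair_cocycle_in[OF P section_cocycle_in[OF s]]
    by (simp_all add: c c')
  ultimately have "(pair_cocycle P (\<chi>, F), pair_cocycle P (\<chi>', F')) \<in> cohomologous G V \<rho>"
    unfolding cohomologous_def P' pair_cocycle_def by auto
  then show ?thesis
    unfolding Wells_def cohom_class_def t_def[symmetric] c c'
    by (rule equiv_class_eq[OF equiv_cohomologous])
qed

end

end

theory Submission
  imports Defs
begin

text \<open>
  A section \<open>s\<close> splits \<open>E\<close> as a vector space: every element is uniquely \<open>i v + s x\<close>. A linear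
  endomorphism \<open>D\<close> of \<open>E\<close> that preserves \<open>i(V)\<close> and induces \<open>(DV, Dg)\<close> is therefore triangular,
  \<open>D (i v) = i (DV v)\<close> and \<open>D (s x) = s (Dg x) + i (\<phi> x)\<close>,
  and the only freedom in it is a linear map \<open>\<phi>\<close> from \<open>G\<close> to \<open>V\<close>. The theorem comes out of
  computing how far such a \<open>D\<close> is from being a derivation that commutes with the operator.
  Each defect lies in \<open>i(V)\<close>:
  \<^item> on a pair \<open>(s x, i v)\<close> it is the defect of compatibility of \<open>(DV, Dg)\<close> with \<open>\<rho>\<close>, whatever
    \<open>\<phi>\<close> is (lemma \<open>defect_section_kernel\<close>);
  \<^item> on a pair \<open>(s x, s y)\<close>, and for the operator on \<open>s x\<close>, it is the cocycle of the pair
    \<open>(DV, Dg)\<close> minus the coboundary of \<open>\<phi>\<close> (lemmas \<open>defect_section_section\<close> and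
    \<open>defect_operator_section\<close>);
  \<^item> within \<open>i(V)\<close> it vanishes, because the bracket there is zero and \<open>DV\<close> commutes with the
    operator of \<open>V\<close>.

  So \<open>D\<close> is a Nijenhuis derivation exactly when \<open>(DV, Dg)\<close> is compatible with \<open>\<rho>\<close> and \<open>\<phi>\<close>
  bounds the cocycle of the pair (lemma \<open>triangular_Der_iff\<close>). Hence only
  compatible pairs lift, and such a pair lifts if and only if its cocycle is a coboundary, that
  is, if and only if its Wells class vanishes.
\<close>

section \<open>Coboundaries and the vanishing of the Wells class\<close>

definition bounds :: "('k::field, 'g::ab_group_add) nla \<Rightarrow> ('k, 'v::ab_group_add) nla
    \<Rightarrow> ('g \<Rightarrow> 'v \<Rightarrow> 'v) \<Rightarrow> ('g \<Rightarrow> 'v) \<Rightarrow> ('g \<Rightarrow> 'g \<Rightarrow> 'v) \<times> ('g \<Rightarrow> 'v) \<Rightarrow> bool" where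
  "bounds G V \<rho> \<phi> c \<longleftrightarrow>
     (\<forall>x y. fst c x y = \<rho> x (\<phi> y) - \<rho> y (\<phi> x) - \<phi> (brk G x y)) \<and>
     (\<forall>x. snd c x = nij V (\<phi> x) - \<phi> (nij G x))"

context abelian_extension_loc
begin

lemma linear_zero: "Vector_Spaces.linear (scl G) (scl V) (\<lambda>x. 0)"
  by (intro linearI vs)
    (simp_all add: vs(1) module.scale_zero_right module_iff_vector_space)

lemma zero_two_cocycle: "(\<lambda>x y. 0, \<lambda>x. 0) \<in> two_cocycles G V \<rho>"
  using linear_zero by (simp add: two_cocycles_def bilin_def lf)

lemma Wells_zero_iff:
  assumes "P \<in> D_rho V G \<rho>"
  shows "Wells V i E p G \<rho> P = H2_zero G V \<rho> \<longleftrightarrow>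
    (\<exists>\<phi>. Vector_Spaces.linear (scl G) (scl V) \<phi> \<and>
      bounds G V \<rho> \<phi> (pair_cocycle P (section_cocycle i E G (some_section G E p))))"
proof -
  define c where "c = pair_cocycle P (section_cocycle i E G (some_section G E p))"
  have c: "c \<in> two_cocycles G V \<rho>"
    unfolding c_def by (intro pair_cocycle_in section_cocycle_in section_exists[OF ext] assms)
  have "Wells V i E p G \<rho> P = H2_zero G V \<rho> \<longleftrightarrow> (c, (\<lambda>x y. 0, \<lambda>x. 0)) \<in> cohomologous G V \<rho>"
    unfolding Wells_def H2_zero_def cohom_class_def c_def[symmetric]
    by (rule eq_equiv_class_iff[OF equiv_cohomologous c zero_two_cocycle])
  also have "\<dots> \<longleftrightarrow> (\<exists>\<phi>. Vector_Spaces.linear (scl G) (scl V) \<phi> \<and> bounds G V \<rho> \<phi> c)"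
    using c zero_two_cocycle by (cases c) (auto simp: cohomologous_def bounds_def)
  finally show ?thesis unfolding c_def .
qed

end

section \<open>Triangular maps over a pair of derivations\<close>

locale triangular_map = abelian_extension_loc V i E p G \<rho>
  for V :: "('k::field, 'v::ab_group_add) nla" and i :: "'v \<Rightarrow> 'e::ab_group_add"
    and E :: "('k, 'e) nla" and p :: "'e \<Rightarrow> 'g::ab_group_add"
    and G :: "('k, 'g) nla" and \<rho> :: "'g \<Rightarrow> 'v \<Rightarrow> 'v" +
  fixes s :: "'g \<Rightarrow> 'e" and DV :: "'v \<Rightarrow> 'v" and Dg :: "'g \<Rightarrow> 'g"
    and D :: "'e \<Rightarrow> 'e" and \<phi> :: "'g \<Rightarrow> 'v"
  assumes s: "is_section G E p s"
    and DV: "DV \<in> Der V" and Dg: "Dg \<in> Der G"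
    and D: "Vector_Spaces.linear (scl E) (scl E) D"
    and D_i: "D (i v) = i (DV v)"
    and D_s: "D (s x) = s (Dg x) + i (\<phi> x)"
begin

abbreviation "cocycle \<equiv> section_cocycle i E G s"
abbreviation "defect_cocycle \<equiv> pair_cocycle (DV, Dg) cocycle"

lemma DV_nij: "nij V (DV v) = DV (nij V v)"
  and Dg_nij: "nij G (Dg x) = Dg (nij G x)"
  and Dg_brk: "Dg (brk G x y) = brk G (Dg x) y + brk G x (Dg y)"
  using DV Dg by (auto simp: Der_def fun_eq_iff)

lemmas ls = linear_facts[OF sect(1)[OF s]]
lemmas lD = linear_facts[OF D]

lemma brk_section_section:
  "brk E (s x) (s y) = i (fst cocycle x y) + s (brk G x y)"
  by (simp add: i_section_cocycle[OF s])

lemma nij_section: "nij E (s x) = i (snd cocycle x) + s (nij G x)"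
  by (simp add: i_section_cocycle[OF s])

lemma brk_section_kernel: "brk E (s x) (i v) = i (\<rho> x v)" "brk E (i v) (s x) = - i (\<rho> x v)"
  using anti(2)[of "i v" "s x"] by (simp_all add: act[OF s])

lemma pair_cocycle_components:
  "fst defect_cocycle x y = DV (fst cocycle x y) - fst cocycle (Dg x) y - fst cocycle x (Dg y)"
  "snd defect_cocycle x = DV (snd cocycle x) - snd cocycle (Dg x)"
  by (simp_all add: pair_cocycle_def split: prod.split)

text \<open>
  This defect does not involve \<open>\<phi>\<close>: the correction \<open>i (\<phi> x)\<close> drops out because \<open>i(V)\<close> is
  abelian.
\<close>

lemma defect_section_kernel:
  "D (brk E (s x) (i v)) - (brk E (D (s x)) (i v) + brk E (s x) (D (i v)))
    = i (DV (\<rho> x v) - (\<rho> (Dg x) v + \<rho> x (DV v)))"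
  by (simp add: D_i D_s lf brk_section_kernel ip(2))

lemma defect_section_section:
  "D (brk E (s x) (s y)) - (brk E (D (s x)) (s y) + brk E (s x) (D (s y)))
    = i (fst defect_cocycle x y - (\<rho> x (\<phi> y) - \<rho> y (\<phi> x) - \<phi> (brk G x y)))"
  by (simp add: D_i D_s lf ls lD brk_section_kernel brk_section_section Dg_brk
      pair_cocycle_components algebra_simps)

lemma defect_operator_section:
  "D (nij E (s x)) - nij E (D (s x))
    = i (snd defect_cocycle x - (nij V (\<phi> x) - \<phi> (nij G x)))"
  by (simp add: D_i D_s lf ls lD nij_section Dg_nij ip(1)
      pair_cocycle_components algebra_simps)

lemma decompose: obtains v x where "e = i v + s x"
proof -
  have "p (e - s (p e)) = 0" by (simp add: lf sect(2)[OF s])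
  from ip(6)[OF this] have "e = i (inv i (e - s (p e))) + s (p e)" by simp
  then show ?thesis by (rule that)
qed

text \<open>
  Bracket and operator are additive, so a derivation that commutes with the operator can be
  recognised on \<open>i(V)\<close> and \<open>s(G)\<close>; there the defects are \<open>i\<close> applied to the failures of the
  conditions on the right, and \<open>i\<close> is injective.
\<close>

lemma triangular_Der_iff:
  "D \<in> Der E \<longleftrightarrow> (DV, Dg) \<in> D_rho V G \<rho> \<and> bounds G V \<rho> \<phi> defect_cocycle"
proof
  assume "D \<in> Der E"
  then have der: "D (brk E e f) - (brk E (D e) f + brk E e (D f)) = 0"
    and nij: "D (nij E e) - nij E (D e) = 0" for e f
    by (auto simp: Der_def fun_eq_iff)
  have i0: "v = w" if "i (v - w) = 0" for v w
    using i_eq[of "v - w" 0] that by (simp add: lf)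
  have "DV (\<rho> x v) = \<rho> (Dg x) v + \<rho> x (DV v)" for x v
    using defect_section_kernel der by (metis i0)
  moreover have "fst defect_cocycle x y = \<rho> x (\<phi> y) - \<rho> y (\<phi> x) - \<phi> (brk G x y)" for x y
    using defect_section_section der by (metis i0)
  moreover have "snd defect_cocycle x = nij V (\<phi> x) - \<phi> (nij G x)" for x
    using defect_operator_section nij by (metis i0)
  ultimately show "(DV, Dg) \<in> D_rho V G \<rho> \<and> bounds G V \<rho> \<phi> defect_cocycle"
    using DV Dg by (simp add: D_rho_def bounds_def)
next
  assume R: "(DV, Dg) \<in> D_rho V G \<rho> \<and> bounds G V \<rho> \<phi> defect_cocycle"
  have sk: "D (brk E (s x) (i v)) = brk E (D (s x)) (i v) + brk E (s x) (D (i v))" for x v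
    using defect_section_kernel[of x v] R by (simp add: D_rho_def lf)
  have ks: "D (brk E (i v) (s x)) = brk E (D (i v)) (s x) + brk E (i v) (D (s x))" for x v
    using sk[of x v] anti(2)[of "i v"] anti(2)[of "D (i v)"] by (simp add: lD)
  have ss: "D (brk E (s x) (s y)) = brk E (D (s x)) (s y) + brk E (s x) (D (s y))" for x y
    using defect_section_section[of x y] R by (simp add: bounds_def lf)
  have kk: "D (brk E (i v) (i w)) = brk E (D (i v)) (i w) + brk E (i v) (D (i w))" for v w
    by (simp add: ip(2) D_i lD)
  have ns: "D (nij E (s x)) = nij E (D (s x))" for x
    using defect_operator_section[of x] R by (simp add: bounds_def lf)
  have nk: "D (nij E (i v)) = nij E (D (i v))" for v
    by (simp add: D_i ip(1)[symmetric] DV_nij)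
  have "D (brk E e f) = brk E (D e) f + brk E e (D f)" for e f
  proof -
    obtain v x where e: "e = i v + s x" by (rule decompose)
    obtain w y where f: "f = i w + s y" by (rule decompose)
    show ?thesis
      unfolding e f by (simp only: lf lD sk ks ss kk) (simp add: algebra_simps)
  qed
  moreover have "nij E (D e) = D (nij E e)" for e
  proof -
    obtain v x where e: "e = i v + s x" by (rule decompose)
    show ?thesis unfolding e by (simp add: lf lD ns nk)
  qed
  ultimately show "D \<in> Der E" using D by (auto simp: Der_def fun_eq_iff)
qed

end

section \<open>Inducible pairs\<close>

context abelian_extension_loc
begin

text \<open>
  \<open>D (s x)\<close> and \<open>s (Dg x)\<close> lie over the same element of \<open>G\<close>, so their difference comes from \<open>V\<close>;
  this difference is \<open>\<phi>\<close>.
\<close>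

lemma lift_is_triangular:
  assumes s: "is_section G E p s" and DV: "DV \<in> Der V" and Dg: "Dg \<in> Der G"
    and D: "D \<in> Der_sub E (range i)" and eta: "eta i E p G D = (DV, Dg)"
  obtains \<phi> where "triangular_map V i E p G \<rho> s DV Dg D \<phi>"
    "Vector_Spaces.linear (scl G) (scl V) \<phi>"
proof -
  have lin_D: "Vector_Spaces.linear (scl E) (scl E) D"
    using D by (simp add: Der_sub_def Der_def)
  have eqs: "DV = inv i \<circ> D \<circ> i" "Dg = p \<circ> D \<circ> s"
    using eta eta_independent_of_section[OF ext D s] by auto
  have "D (i v) \<in> range i" for v using D by (auto simp: Der_sub_def)
  then have D_i: "D (i v) = i (DV v)" for v
    by (simp add: eqs f_inv_into_f)
  define \<phi> where "\<phi> x = inv i (D (s x) - s (Dg x))" for x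
  have i\<phi>: "i (\<phi> x) = D (s x) - s (Dg x)" for x
    unfolding \<phi>_def by (rule ip(6)) (simp add: lf sect(2)[OF s] eqs)
  have lin_Dg: "Vector_Spaces.linear (scl G) (scl G) Dg"
    using Dg by (simp add: Der_def)
  have S: "scl E a (x - y) = scl E a x - scl E a y" for a x y
    using vs(3) by (simp add: module.scale_right_diff_distrib module_iff_vector_space)
  have "Vector_Spaces.linear (scl G) (scl V) \<phi>"
    by (intro linearI vs i_eq) (simp_all add: lf i\<phi> S linear_facts[OF lin_D]
        linear_facts[OF lin_Dg] linear_facts[OF sect(1)[OF s]])
  moreover have "triangular_map V i E p G \<rho> s DV Dg D \<phi>"
    using s DV Dg lin_D D_i i\<phi>
    by (intro triangular_map.intro triangular_map_axioms.intro abelian_extension_loc_axioms) simp_all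
  ultimately show ?thesis using that by blast
qed

lemma triangular_map_exists:
  assumes s: "is_section G E p s" and DV: "DV \<in> Der V" and Dg: "Dg \<in> Der G"
    and \<phi>: "Vector_Spaces.linear (scl G) (scl V) \<phi>"
  obtains D where "triangular_map V i E p G \<rho> s DV Dg D \<phi>"
proof -
  have lin_DV: "Vector_Spaces.linear (scl V) (scl V) DV"
    and lin_Dg: "Vector_Spaces.linear (scl G) (scl G) Dg"
    using DV Dg by (auto simp: Der_def)
  note l = lf linear_facts[OF lin_DV] linear_facts[OF lin_Dg] linear_facts[OF \<phi>]
    linear_facts[OF sect(1)[OF s]]
  have S: "scl E a (x + y) = scl E a x + scl E a y"
    "scl E a (x - y) = scl E a x - scl E a y" for a x y
    using vs(3) by (simp_all add: module.scale_right_diff_distrib module.scale_right_distrib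
        module_iff_vector_space)
  \<comment> \<open>\<open>r\<close> is the projection of \<open>E\<close> onto \<open>V\<close> along the image of \<open>s\<close>.\<close>
  define r where "r e = inv i (e - s (p e))" for e
  have i_r: "i (r e) = e - s (p e)" for e
    unfolding r_def by (rule ip(6)) (simp add: lf sect(2)[OF s])
  have lin_r: "Vector_Spaces.linear (scl E) (scl V) r"
    by (intro linearI vs i_eq) (simp_all add: l i_r S)
  have r_i: "r (i v) = v" and r_s: "r (s x) = 0" for v x
    by (rule i_eq, simp add: i_r l ip(5) sect(2)[OF s])+
  define D where "D e = i (DV (r e)) + (s (Dg (p e)) + i (\<phi> (p e)))" for e
  have "Vector_Spaces.linear (scl E) (scl E) D"
    unfolding D_def by (intro linearI vs) (simp_all add: l linear_facts[OF lin_r] S)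
  moreover have "D (i v) = i (DV v)" "D (s x) = s (Dg x) + i (\<phi> x)" for v x
    by (simp_all add: D_def r_i r_s l ip(5) sect(2)[OF s])
  ultimately have "triangular_map V i E p G \<rho> s DV Dg D \<phi>"
    using s DV Dg
    by (intro triangular_map.intro triangular_map_axioms.intro abelian_extension_loc_axioms)
  then show ?thesis by (rule that)
qed

lemma triangular_Der_is_lift:
  assumes T: "triangular_map V i E p G \<rho> s DV Dg D \<phi>" and der: "D \<in> Der E"
  shows "D \<in> Der_sub E (range i)" "eta i E p G D = (DV, Dg)"
proof -
  interpret triangular_map V i E p G \<rho> s DV Dg D \<phi> by (rule T)
  show sub: "D \<in> Der_sub E (range i)"
    using der by (auto simp: Der_sub_def D_i)
  show "eta i E p G D = (DV, Dg)"
    unfolding eta_independent_of_section[OF ext sub s]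
    by (simp add: fun_eq_iff D_i D_s inv_f_f[OF ip(7)] lf ip(5) sect(2)[OF s])
qed

text \<open>
  Since every lift of the pair is triangular for some \<open>\<phi>\<close> and every \<open>\<phi>\<close> gives a triangular map,
  the search for a lift reduces to the search for a bounding \<open>\<phi>\<close>.
\<close>

lemma inducible_iff_bounded:
  assumes s: "is_section G E p s" and DV: "DV \<in> Der V" and Dg: "Dg \<in> Der G"
  shows "inducible i E p G (DV, Dg) \<longleftrightarrow> (DV, Dg) \<in> D_rho V G \<rho> \<and>
    (\<exists>\<phi>. Vector_Spaces.linear (scl G) (scl V) \<phi> \<and>
      bounds G V \<rho> \<phi> (pair_cocycle (DV, Dg) (section_cocycle i E G s)))"
    (is "_ \<longleftrightarrow> ?R")
proof
  assume "inducible i E p G (DV, Dg)"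
  then obtain D where D: "D \<in> Der_sub E (range i)" "eta i E p G D = (DV, Dg)"
    by (auto simp: inducible_def)
  obtain \<phi> where T: "triangular_map V i E p G \<rho> s DV Dg D \<phi>"
    and \<phi>: "Vector_Spaces.linear (scl G) (scl V) \<phi>"
    by (rule lift_is_triangular[OF s DV Dg D])
  have "D \<in> Der E" using D by (simp add: Der_sub_def)
  with \<phi> show ?R unfolding triangular_map.triangular_Der_iff[OF T] by blast
next
  assume R: ?R
  then obtain \<phi> where \<phi>: "Vector_Spaces.linear (scl G) (scl V) \<phi>"
    and b: "bounds G V \<rho> \<phi> (pair_cocycle (DV, Dg) (section_cocycle i E G s))"
    by blast
  obtain D where T: "triangular_map V i E p G \<rho> s DV Dg D \<phi>"
    by (rule triangular_map_exists[OF s DV Dg \<phi>])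
  have "D \<in> Der E" using R b by (simp add: triangular_map.triangular_Der_iff[OF T])
  from triangular_Der_is_lift[OF T this] show "inducible i E p G (DV, Dg)"
    unfolding inducible_def by (metis imageI)
qed

end

theorem theorem5p4:
  fixes V :: "('k::field, 'v::ab_group_add) nla"
    and E :: "('k, 'e::ab_group_add) nla"
    and G :: "('k, 'g::ab_group_add) nla"
    and i :: "'v \<Rightarrow> 'e" and p :: "'e \<Rightarrow> 'g" and \<rho> :: "'g \<Rightarrow> 'v \<Rightarrow> 'v"
    and DV :: "'v \<Rightarrow> 'v" and Dg :: "'g \<Rightarrow> 'g"
  assumes "nijenhuis_lie G"
    and "nijenhuis_representation G (scl V) \<rho> (nij V)"
    and "abelian_extension V i E p G \<rho>"
    and "(DV, Dg) \<in> Der V \<times> Der G"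
  shows "inducible i E p G (DV, Dg) \<longleftrightarrow>
    (DV, Dg) \<in> D_rho V G \<rho> \<and> Wells V i E p G \<rho> (DV, Dg) = H2_zero G V \<rho>"
proof -
  interpret abelian_extension_loc V i E p G \<rho>
    using assms(2,3) by unfold_locales
  from assms(4) have "DV \<in> Der V" "Dg \<in> Der G" by auto
  from inducible_iff_bounded[OF section_exists[OF ext] this] Wells_zero_iff
  show ?thesis by blast
qed

end
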